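(* Let $R$ be a commutative ring with identity, let $S$ be a multiplicative subset of $R$, and let $N$ be an $R$-submodule of an $R$-module $M$. Then $\mathrm{Sat}_{S,M}(N)$ is $S$-finite if and only if $N$ is $S$-finite and $\mathrm{Sat}_{S,M}(N)=(N:_M s)$ for some $s\in S$.
   Context: All rings are commutative with identity and all modules are unitary. A multiplicative subset of $R$ is a subset containing $1$ and closed under multiplication. An $R$-module $M$ is $S$-finite if there exist a finitely generated submodule $N$ of $M$ and $s\in S$ such that $sM\subseteq N$. For an inclusion $N\subseteq M$ of $R$-modules, let $f:M\to M_S$ be the canonical homomorphism to the localization at $S$, and let $f(N)R_S$ be the $R_S$-submodule of $M_S$ generated by $f(N)$. Then $\mathrm{Sat}_{S,M}(N):=f^{-1}(f(N)R_S)$, and for $s\in S$, $(N:_M s):=\{m\in M : sm\in N\}$. *)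

theory Defs
  imports "HOL-Algebra.Module"
begin

section \<open>Finite generation and \<open>S\<close>-finiteness\<close>

text \<open>
  A multiplicative subset \<open>S\<close> of \<open>R\<close> is a \<^term>\<open>submonoid S R\<close>; \<open>0 \<in> S\<close> is allowed.
  A submodule \<open>N\<close> of \<open>M\<close> is regarded as a module in its own right via \<^term>\<open>M\<lparr>carrier := N\<rparr>\<close>.
\<close>

definition generated_submodule ::
  "('a, 'x) ring_scheme \<Rightarrow> ('a, 'b, 'y) module_scheme \<Rightarrow> 'b set \<Rightarrow> 'b set" where
  "generated_submodule R M A = \<Inter>{H. submodule H R M \<and> A \<subseteq> H}"

definition finitely_generated_module ::
  "('a, 'x) ring_scheme \<Rightarrow> ('a, 'b, 'y) module_scheme \<Rightarrow> bool" where
  "finitely_generated_module R M \<longleftrightarrow>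
     (\<exists>A. finite A \<and> A \<subseteq> carrier M \<and> generated_submodule R M A = carrier M)"

definition S_finite ::
  "('a, 'x) ring_scheme \<Rightarrow> 'a set \<Rightarrow> ('a, 'b, 'y) module_scheme \<Rightarrow> bool" where
  "S_finite R S M \<longleftrightarrow>
     (\<exists>N s. submodule N R M \<and> finitely_generated_module R (M\<lparr>carrier := N\<rparr>) \<and> s \<in> S \<and>
        (\<lambda>m. s \<odot>\<^bsub>M\<^esub> m) ` carrier M \<subseteq> N)"


section \<open>Localization at a multiplicative subset\<close>

definition loc_rel ::
  "('a, 'x) ring_scheme \<Rightarrow> 'a set \<Rightarrow> ('a, 'b, 'y) module_scheme \<Rightarrow> (('b \<times> 'a) \<times> ('b \<times> 'a)) set" where
  "loc_rel R S M = {((m, s), (n, t)). m \<in> carrier M \<and> n \<in> carrier M \<and> s \<in> S \<and> t \<in> S \<and>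
     (\<exists>u\<in>S. u \<odot>\<^bsub>M\<^esub> (t \<odot>\<^bsub>M\<^esub> m) = u \<odot>\<^bsub>M\<^esub> (s \<odot>\<^bsub>M\<^esub> n))}"

definition frac ::
  "('a, 'x) ring_scheme \<Rightarrow> 'a set \<Rightarrow> ('a, 'b, 'y) module_scheme \<Rightarrow> 'b \<Rightarrow> 'a \<Rightarrow> ('b \<times> 'a) set" where
  "frac R S M m s = loc_rel R S M `` {(m, s)}"

text \<open>The ring as a module over itself, so that its fractions are an instance of the above.\<close>

definition self_module :: "('a, 'x) ring_scheme \<Rightarrow> ('a, 'a) module" where
  "self_module R = \<lparr>carrier = carrier R, mult = mult R, one = one R, zero = zero R, add = add R,
     smult = mult R\<rparr>"

text \<open>
  The operations below are given on equivalence classes by taking the union over all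
  representatives; the rules \<open>loc_add\<close>, \<open>loc_smult\<close> and \<open>loc_mult\<close> are the usual formulas
  for fractions.
\<close>

definition loc_ring :: "('a, 'x) ring_scheme \<Rightarrow> 'a set \<Rightarrow> ('a \<times> 'a) set ring" where
  "loc_ring R S =
     \<lparr>carrier = (carrier R \<times> S) // loc_rel R S (self_module R),
      mult = (\<lambda>X Y. \<Union>(a, s)\<in>X. \<Union>(b, t)\<in>Y. frac R S (self_module R) (a \<otimes>\<^bsub>R\<^esub> b) (s \<otimes>\<^bsub>R\<^esub> t)),
      one = frac R S (self_module R) \<one>\<^bsub>R\<^esub> \<one>\<^bsub>R\<^esub>,
      zero = frac R S (self_module R) \<zero>\<^bsub>R\<^esub> \<one>\<^bsub>R\<^esub>,
      add = (\<lambda>X Y. \<Union>(a, s)\<in>X. \<Union>(b, t)\<in>Y.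
        frac R S (self_module R) ((t \<otimes>\<^bsub>R\<^esub> a) \<oplus>\<^bsub>R\<^esub> (s \<otimes>\<^bsub>R\<^esub> b)) (s \<otimes>\<^bsub>R\<^esub> t))\<rparr>"

text \<open>The fields \<^const>\<open>mult\<close> and \<^const>\<open>one\<close> of a module record play no role for a module.\<close>

definition loc_module ::
  "('a, 'x) ring_scheme \<Rightarrow> 'a set \<Rightarrow> ('a, 'b, 'y) module_scheme \<Rightarrow>
     (('a \<times> 'a) set, ('b \<times> 'a) set) module" where
  "loc_module R S M =
     \<lparr>carrier = (carrier M \<times> S) // loc_rel R S M,
      mult = undefined,
      one = undefined,
      zero = frac R S M \<zero>\<^bsub>M\<^esub> \<one>\<^bsub>R\<^esub>,
      add = (\<lambda>X Y. \<Union>(m, s)\<in>X. \<Union>(n, t)\<in>Y.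
        frac R S M ((t \<odot>\<^bsub>M\<^esub> m) \<oplus>\<^bsub>M\<^esub> (s \<odot>\<^bsub>M\<^esub> n)) (s \<otimes>\<^bsub>R\<^esub> t)),
      smult = (\<lambda>X Y. \<Union>(a, s)\<in>X. \<Union>(m, t)\<in>Y. frac R S M (a \<odot>\<^bsub>M\<^esub> m) (s \<otimes>\<^bsub>R\<^esub> t))\<rparr>"

definition loc_map ::
  "('a, 'x) ring_scheme \<Rightarrow> 'a set \<Rightarrow> ('a, 'b, 'y) module_scheme \<Rightarrow> 'b \<Rightarrow> ('b \<times> 'a) set" where
  "loc_map R S M m = frac R S M m \<one>\<^bsub>R\<^esub>"


section \<open>Saturation and colon submodule\<close>

definition Sat ::
  "('a, 'x) ring_scheme \<Rightarrow> 'a set \<Rightarrow> ('a, 'b, 'y) module_scheme \<Rightarrow> 'b set \<Rightarrow> 'b set" where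
  "Sat R S M N = {m \<in> carrier M. loc_map R S M m \<in>
     generated_submodule (loc_ring R S) (loc_module R S M) (loc_map R S M ` N)}"

definition colon :: "('a, 'b, 'y) module_scheme \<Rightarrow> 'b set \<Rightarrow> 'a \<Rightarrow> 'b set" where
  "colon M N s = {m \<in> carrier M. s \<odot>\<^bsub>M\<^esub> m \<in> N}"


section \<open>The localization is a module over the localized ring\<close>

lemma self_module_sel [simp]:
  "carrier (self_module R) = carrier R" "zero (self_module R) = zero R"
  "add (self_module R) = add R" "smult (self_module R) = mult R"
  by (simp_all add: self_module_def)

lemma self_module_module:
  assumes "cring R" shows "module R (self_module R)"
proof -
  interpret cring R by fact
  show ?thesis
  proof (rule moduleI)
    show "abelian_group (self_module R)"
    proof (rule abelian_groupI)
      show "\<exists>y\<in>carrier (self_module R). y \<oplus>\<^bsub>self_module R\<^esub> x = \<zero>\<^bsub>self_module R\<^esub>"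
        if "x \<in> carrier (self_module R)" for x
        using that by (intro bexI[of _ "\<ominus>\<^bsub>R\<^esub> x"]) (simp_all add: l_neg)
    qed (simp_all add: a_ac)
  qed (simp_all add: assms l_distr r_distr m_assoc)
qed

lemma UN_const2:
  assumes "(m0, s0) \<in> X" "(n0, t0) \<in> Y"
    and "\<And>m s n t. (m, s) \<in> X \<Longrightarrow> (n, t) \<in> Y \<Longrightarrow> f m s n t = c"
  shows "(\<Union>(m, s)\<in>X. \<Union>(n, t)\<in>Y. f m s n t) = c"
proof -
  have "(\<Union>(m, s)\<in>X. \<Union>(n, t)\<in>Y. f m s n t) = (\<Union>(m, s)\<in>X. \<Union>(n, t)\<in>Y. c)"
    using assms(3) by (intro SUP_cong refl) (auto split: prod.split)
  also have "\<dots> = c"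
    using assms(1,2) by (auto simp: case_prod_beta)
  finally show ?thesis .
qed

locale mult_loc = module R M + S: submonoid S R
  for R (structure) and M (structure) and S
begin

abbreviation "fr \<equiv> frac R S M"
abbreviation "L \<equiv> loc_module R S M"

lemma S_R [simp, intro]: "s \<in> S \<Longrightarrow> s \<in> carrier R"
  using S.subset by auto

lemma smult_left_commute:
  assumes "a \<in> carrier R" "b \<in> carrier R" "x \<in> carrier M"
  shows "a \<odot>\<^bsub>M\<^esub> (b \<odot>\<^bsub>M\<^esub> x) = b \<odot>\<^bsub>M\<^esub> (a \<odot>\<^bsub>M\<^esub> x)"
  using assms by (metis R.m_comm smult_assoc1)

lemma loc_rel_equiv: "equiv (carrier M \<times> S) (loc_rel R S M)"
proof (rule equivI)
  show "trans (loc_rel R S M)"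
  proof (rule transI, clarify)
    fix m s n t p w
    assume "((m, s), (n, t)) \<in> loc_rel R S M" and "((n, t), (p, w)) \<in> loc_rel R S M"
    then obtain u v where c: "m \<in> carrier M" "n \<in> carrier M" "p \<in> carrier M"
        "s \<in> S" "t \<in> S" "w \<in> S" "u \<in> S" "v \<in> S"
      and 1: "u \<odot>\<^bsub>M\<^esub> (t \<odot>\<^bsub>M\<^esub> m) = u \<odot>\<^bsub>M\<^esub> (s \<odot>\<^bsub>M\<^esub> n)"
      and 2: "v \<odot>\<^bsub>M\<^esub> (w \<odot>\<^bsub>M\<^esub> n) = v \<odot>\<^bsub>M\<^esub> (t \<odot>\<^bsub>M\<^esub> p)"
      by (auto simp: loc_rel_def)
    let ?k = "t \<otimes> (u \<otimes> v)"
    have "?k \<odot>\<^bsub>M\<^esub> (w \<odot>\<^bsub>M\<^esub> m) = (v \<otimes> w) \<odot>\<^bsub>M\<^esub> (u \<odot>\<^bsub>M\<^esub> (t \<odot>\<^bsub>M\<^esub> m))"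
      using c by (simp add: smult_assoc1[symmetric] R.m_ac)
    also have "\<dots> = (u \<otimes> s) \<odot>\<^bsub>M\<^esub> (v \<odot>\<^bsub>M\<^esub> (w \<odot>\<^bsub>M\<^esub> n))"
      unfolding 1 using c by (simp add: smult_assoc1[symmetric] R.m_ac)
    also have "\<dots> = ?k \<odot>\<^bsub>M\<^esub> (s \<odot>\<^bsub>M\<^esub> p)"
      unfolding 2 using c by (simp add: smult_assoc1[symmetric] R.m_ac)
    finally show "((m, s), (p, w)) \<in> loc_rel R S M"
      using c by (auto simp: loc_rel_def intro!: bexI[of _ ?k])
  qed
next
  show "refl_on (carrier M \<times> S) (loc_rel R S M)"
    using S.one_closed by (auto simp: loc_rel_def refl_on_def)
  show "sym (loc_rel R S M)"
    by (rule symI) (simp add: loc_rel_def case_prod_beta, metis)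
  show "loc_rel R S M \<subseteq> (carrier M \<times> S) \<times> (carrier M \<times> S)"
    by (auto simp: loc_rel_def)
qed

lemma fr_eq_iff:
  assumes "m \<in> carrier M" "n \<in> carrier M" "s \<in> S" "t \<in> S"
  shows "fr m s = fr n t \<longleftrightarrow> (\<exists>u\<in>S. u \<odot>\<^bsub>M\<^esub> (t \<odot>\<^bsub>M\<^esub> m) = u \<odot>\<^bsub>M\<^esub> (s \<odot>\<^bsub>M\<^esub> n))"
  unfolding frac_def using assms
  by (subst eq_equiv_class_iff[OF loc_rel_equiv]) (auto simp: loc_rel_def)

lemma fr_eqI:
  assumes "m \<in> carrier M" "n \<in> carrier M" "s \<in> S" "t \<in> S" "t \<odot>\<^bsub>M\<^esub> m = s \<odot>\<^bsub>M\<^esub> n"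
  shows "fr m s = fr n t"
  using assms by (auto simp: fr_eq_iff)

lemma mem_fr:
  assumes "m \<in> carrier M" "s \<in> S"
  shows "(n, t) \<in> fr m s \<longleftrightarrow> n \<in> carrier M \<and> t \<in> S \<and> fr n t = fr m s"
proof -
  have "(n, t) \<in> fr m s \<longleftrightarrow> n \<in> carrier M \<and> t \<in> S \<and> ((m, s), (n, t)) \<in> loc_rel R S M"
    by (auto simp: frac_def loc_rel_def)
  also have "\<dots> \<longleftrightarrow> n \<in> carrier M \<and> t \<in> S \<and> fr m s = fr n t"
    unfolding frac_def
    using assms eq_equiv_class_iff[OF loc_rel_equiv, of "(m, s)" "(n, t)"] by blast
  finally show ?thesis
    by metis
qed

lemma mem_frD:
  assumes "(n, t) \<in> fr m s" "m \<in> carrier M" "s \<in> S"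
  shows "n \<in> carrier M" "t \<in> S" "\<exists>u\<in>S. u \<odot>\<^bsub>M\<^esub> (s \<odot>\<^bsub>M\<^esub> n) = u \<odot>\<^bsub>M\<^esub> (t \<odot>\<^bsub>M\<^esub> m)"
  using assms mem_fr[of m s n t] fr_eq_iff[of n m t s] by auto

lemma fr_self: "m \<in> carrier M \<Longrightarrow> s \<in> S \<Longrightarrow> (m, s) \<in> fr m s"
  by (simp add: mem_fr)

lemma loc_carrier: "carrier L = {fr m s | m s. m \<in> carrier M \<and> s \<in> S}"
  by (auto simp: loc_module_def quotient_def frac_def)

lemma fr_in [simp]: "m \<in> carrier M \<Longrightarrow> s \<in> S \<Longrightarrow> fr m s \<in> carrier L"
  by (auto simp: loc_carrier)

lemma loc_zero: "\<zero>\<^bsub>L\<^esub> = fr \<zero>\<^bsub>M\<^esub> \<one>"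
  by (simp add: loc_module_def)

lemma loc_add:
  assumes "m \<in> carrier M" "n \<in> carrier M" "s \<in> S" "t \<in> S"
  shows "fr m s \<oplus>\<^bsub>L\<^esub> fr n t = fr ((t \<odot>\<^bsub>M\<^esub> m) \<oplus>\<^bsub>M\<^esub> (s \<odot>\<^bsub>M\<^esub> n)) (s \<otimes> t)"
proof -
  have "fr ((t' \<odot>\<^bsub>M\<^esub> m') \<oplus>\<^bsub>M\<^esub> (s' \<odot>\<^bsub>M\<^esub> n')) (s' \<otimes> t') = fr ((t \<odot>\<^bsub>M\<^esub> m) \<oplus>\<^bsub>M\<^esub> (s \<odot>\<^bsub>M\<^esub> n)) (s \<otimes> t)"
    if mem: "(m', s') \<in> fr m s" "(n', t') \<in> fr n t" for m' s' n' t'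
  proof -
    obtain u v where c: "m' \<in> carrier M" "n' \<in> carrier M" "s' \<in> S" "t' \<in> S" "u \<in> S" "v \<in> S"
      and 1: "u \<odot>\<^bsub>M\<^esub> (s \<odot>\<^bsub>M\<^esub> m') = u \<odot>\<^bsub>M\<^esub> (s' \<odot>\<^bsub>M\<^esub> m)"
      and 2: "v \<odot>\<^bsub>M\<^esub> (t \<odot>\<^bsub>M\<^esub> n') = v \<odot>\<^bsub>M\<^esub> (t' \<odot>\<^bsub>M\<^esub> n)"
      using mem_frD[OF mem(1) assms(1,3)] mem_frD[OF mem(2) assms(2,4)] by blast
    have "(u \<otimes> v) \<odot>\<^bsub>M\<^esub> ((s \<otimes> t) \<odot>\<^bsub>M\<^esub> ((t' \<odot>\<^bsub>M\<^esub> m') \<oplus>\<^bsub>M\<^esub> (s' \<odot>\<^bsub>M\<^esub> n')))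
      = (v \<otimes> t \<otimes> t') \<odot>\<^bsub>M\<^esub> (u \<odot>\<^bsub>M\<^esub> (s \<odot>\<^bsub>M\<^esub> m')) \<oplus>\<^bsub>M\<^esub> (u \<otimes> s \<otimes> s') \<odot>\<^bsub>M\<^esub> (v \<odot>\<^bsub>M\<^esub> (t \<odot>\<^bsub>M\<^esub> n'))"
      using c assms by (simp add: smult_assoc1[symmetric] R.m_ac smult_r_distr)
    also have "\<dots> = (u \<otimes> v) \<odot>\<^bsub>M\<^esub> ((s' \<otimes> t') \<odot>\<^bsub>M\<^esub> ((t \<odot>\<^bsub>M\<^esub> m) \<oplus>\<^bsub>M\<^esub> (s \<odot>\<^bsub>M\<^esub> n)))"
      unfolding 1 2 using c assms by (simp add: smult_assoc1[symmetric] R.m_ac smult_r_distr)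
    finally show ?thesis
      using c assms by (subst fr_eq_iff) (auto intro!: bexI[of _ "u \<otimes> v"])
  qed
  then show ?thesis
    unfolding loc_module_def
    by (simp, intro UN_const2[OF fr_self fr_self]) (use assms in auto)
qed

end

context mult_loc
begin

abbreviation "frR \<equiv> frac R S (self_module R)"
abbreviation "RS \<equiv> loc_ring R S"

lemma self_loc: "mult_loc R (self_module R) S"
  by (simp add: mult_loc_def self_module_module R.is_cring S.submonoid_axioms)

interpretation self: mult_loc R "self_module R" S
  by (rule self_loc)

lemma loc_smult:
  assumes "a \<in> carrier R" "m \<in> carrier M" "s \<in> S" "t \<in> S"
  shows "frR a s \<odot>\<^bsub>L\<^esub> fr m t = fr (a \<odot>\<^bsub>M\<^esub> m) (s \<otimes> t)"
proof -
  have "fr (a' \<odot>\<^bsub>M\<^esub> m') (s' \<otimes> t') = fr (a \<odot>\<^bsub>M\<^esub> m) (s \<otimes> t)"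
    if mem: "(a', s') \<in> frR a s" "(m', t') \<in> fr m t" for a' s' m' t'
  proof -
    obtain u v where c: "a' \<in> carrier R" "m' \<in> carrier M" "s' \<in> S" "t' \<in> S" "u \<in> S" "v \<in> S"
      and 1: "u \<otimes> (s \<otimes> a') = u \<otimes> (s' \<otimes> a)"
      and 2: "v \<odot>\<^bsub>M\<^esub> (t \<odot>\<^bsub>M\<^esub> m') = v \<odot>\<^bsub>M\<^esub> (t' \<odot>\<^bsub>M\<^esub> m)"
      using self.mem_frD[OF mem(1)] mem_frD[OF mem(2)] assms by (simp, blast)
    have "(u \<otimes> v) \<odot>\<^bsub>M\<^esub> ((s \<otimes> t) \<odot>\<^bsub>M\<^esub> (a' \<odot>\<^bsub>M\<^esub> m')) = (u \<otimes> (s \<otimes> a')) \<odot>\<^bsub>M\<^esub> (v \<odot>\<^bsub>M\<^esub> (t \<odot>\<^bsub>M\<^esub> m'))"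
      using c assms by (simp add: smult_assoc1[symmetric] R.m_ac)
    also have "\<dots> = (u \<otimes> v) \<odot>\<^bsub>M\<^esub> ((s' \<otimes> t') \<odot>\<^bsub>M\<^esub> (a \<odot>\<^bsub>M\<^esub> m))"
      unfolding 1 2 using c assms by (simp add: smult_assoc1[symmetric] R.m_ac)
    finally show ?thesis
      using c assms by (subst fr_eq_iff) (auto intro!: bexI[of _ "u \<otimes> v"])
  qed
  then show ?thesis
    unfolding loc_module_def
    by (simp, intro UN_const2[OF self.fr_self fr_self]) (use assms in auto)
qed

end

context mult_loc
begin

interpretation self: mult_loc R "self_module R" S
  by (rule self_loc)

lemma RS_sel:
  "carrier RS = carrier (loc_module R S (self_module R))"
  "add RS = add (loc_module R S (self_module R))"
  "zero RS = zero (loc_module R S (self_module R))"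
  "mult RS = smult (loc_module R S (self_module R))"
  "\<one>\<^bsub>RS\<^esub> = frR \<one> \<one>"
  by (simp_all add: loc_ring_def loc_module_def)

lemma loc_abelian: "abelian_group L"
proof (rule abelian_groupI)
  fix x assume "x \<in> carrier L"
  then obtain m s where x: "x = fr m s" and c: "m \<in> carrier M" "s \<in> S" by (auto simp: loc_carrier)
  show "\<zero>\<^bsub>L\<^esub> \<oplus>\<^bsub>L\<^esub> x = x" using c by (simp add: x loc_zero loc_add)
  have "fr (\<ominus>\<^bsub>M\<^esub> m) s \<oplus>\<^bsub>L\<^esub> x = \<zero>\<^bsub>L\<^esub>"
    unfolding x loc_zero using c
    by (subst loc_add) (simp_all add: smult_r_minus M.l_neg, rule fr_eqI, simp_all)
  then show "\<exists>y\<in>carrier L. y \<oplus>\<^bsub>L\<^esub> x = \<zero>\<^bsub>L\<^esub>" using c by (intro bexI[of _ "fr (\<ominus>\<^bsub>M\<^esub> m) s"]) auto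
next
  fix x y z assume "x \<in> carrier L" "y \<in> carrier L" "z \<in> carrier L"
  then show "x \<oplus>\<^bsub>L\<^esub> y \<oplus>\<^bsub>L\<^esub> z = x \<oplus>\<^bsub>L\<^esub> (y \<oplus>\<^bsub>L\<^esub> z)"
    by (auto simp: loc_carrier loc_add smult_r_distr smult_assoc1[symmetric] R.m_ac M.a_ac)
qed (auto simp: loc_zero, auto simp: loc_carrier loc_add M.a_comm R.m_comm, blast)

lemma loc_smult_r_distr:
  assumes "x \<in> carrier RS" "y \<in> carrier L" "z \<in> carrier L"
  shows "x \<odot>\<^bsub>L\<^esub> (y \<oplus>\<^bsub>L\<^esub> z) = x \<odot>\<^bsub>L\<^esub> y \<oplus>\<^bsub>L\<^esub> x \<odot>\<^bsub>L\<^esub> z"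
proof -
  obtain a r m s n t where c: "a \<in> carrier R" "r \<in> S" "m \<in> carrier M" "s \<in> S" "n \<in> carrier M" "t \<in> S"
    and e: "x = frR a r" "y = fr m s" "z = fr n t"
    using assms by (auto simp: RS_sel loc_carrier self.loc_carrier)
  show ?thesis
    unfolding e using c
    by (simp add: loc_add loc_smult, intro fr_eqI)
       (simp_all add: smult_r_distr smult_assoc1[symmetric] R.m_ac)
qed

lemma loc_smult_l_distr:
  assumes "x \<in> carrier RS" "y \<in> carrier RS" "z \<in> carrier L"
  shows "(x \<oplus>\<^bsub>RS\<^esub> y) \<odot>\<^bsub>L\<^esub> z = x \<odot>\<^bsub>L\<^esub> z \<oplus>\<^bsub>L\<^esub> y \<odot>\<^bsub>L\<^esub> z"
proof -
  obtain a r b s m t where c: "a \<in> carrier R" "r \<in> S" "b \<in> carrier R" "s \<in> S" "m \<in> carrier M" "t \<in> S"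
    and e: "x = frR a r" "y = frR b s" "z = fr m t"
    using assms by (auto simp: RS_sel loc_carrier self.loc_carrier)
  have "frR a r \<oplus>\<^bsub>RS\<^esub> frR b s = frR (s \<otimes> a \<oplus> r \<otimes> b) (r \<otimes> s)"
    using c self.loc_add[of a b r s] by (simp add: RS_sel)
  then show ?thesis
    unfolding e using c
    by (simp add: loc_add loc_smult, intro fr_eqI)
       (simp_all add: smult_r_distr smult_l_distr smult_assoc1[symmetric] R.m_ac R.r_distr R.l_distr)
qed

lemma loc_mult:
  assumes "a \<in> carrier R" "b \<in> carrier R" "s \<in> S" "t \<in> S"
  shows "frR a s \<otimes>\<^bsub>RS\<^esub> frR b t = frR (a \<otimes> b) (s \<otimes> t)"
  using assms self.loc_smult[of a b s t] by (simp add: RS_sel)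

lemma loc_smult_assoc:
  assumes "x \<in> carrier RS" "y \<in> carrier RS" "z \<in> carrier L"
  shows "(x \<otimes>\<^bsub>RS\<^esub> y) \<odot>\<^bsub>L\<^esub> z = x \<odot>\<^bsub>L\<^esub> (y \<odot>\<^bsub>L\<^esub> z)"
proof -
  obtain a r b s m t where c: "a \<in> carrier R" "r \<in> S" "b \<in> carrier R" "s \<in> S" "m \<in> carrier M" "t \<in> S"
    and e: "x = frR a r" "y = frR b s" "z = fr m t"
    using assms by (auto simp: RS_sel loc_carrier self.loc_carrier)
  show ?thesis
    unfolding e using c by (simp add: loc_mult loc_smult smult_assoc1 R.m_assoc)
qed

lemma loc_smult_closed: "x \<in> carrier RS \<Longrightarrow> y \<in> carrier L \<Longrightarrow> x \<odot>\<^bsub>L\<^esub> y \<in> carrier L"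
  by (auto simp: RS_sel loc_carrier self.loc_carrier loc_smult) blast

lemma loc_smult_one: "y \<in> carrier L \<Longrightarrow> \<one>\<^bsub>RS\<^esub> \<odot>\<^bsub>L\<^esub> y = y"
  by (auto simp: RS_sel loc_carrier loc_smult)

end

context mult_loc
begin

interpretation self: mult_loc R "self_module R" S
  by (rule self_loc)

lemma loc_ring_cring: "cring RS"
proof (rule cringI)
  interpret A: abelian_group "loc_module R S (self_module R)"
    by (rule self.loc_abelian)
  show "abelian_group RS"
    by (rule abelian_groupI) (use A.a_inv_closed A.l_neg in \<open>auto simp: RS_sel A.a_ac\<close>)
  have comm: "x \<otimes>\<^bsub>RS\<^esub> y = y \<otimes>\<^bsub>RS\<^esub> x" if "x \<in> carrier RS" "y \<in> carrier RS" for x y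
    using that by (auto simp: RS_sel(1) self.loc_carrier loc_mult R.m_comm)
  show "comm_monoid RS"
  proof (rule comm_monoidI)
    show "\<one>\<^bsub>RS\<^esub> \<in> carrier RS" by (simp add: RS_sel)
    fix x y z assume x: "x \<in> carrier RS" and y: "y \<in> carrier RS"
    show "x \<otimes>\<^bsub>RS\<^esub> y \<in> carrier RS"
      using self.loc_smult_closed[of x y] x y by (simp add: RS_sel)
    show "x \<otimes>\<^bsub>RS\<^esub> y = y \<otimes>\<^bsub>RS\<^esub> x" by (rule comm[OF x y])
    show "\<one>\<^bsub>RS\<^esub> \<otimes>\<^bsub>RS\<^esub> x = x"
      using self.loc_smult_one[of x] x by (simp add: RS_sel)
    assume z: "z \<in> carrier RS"
    show "x \<otimes>\<^bsub>RS\<^esub> y \<otimes>\<^bsub>RS\<^esub> z = x \<otimes>\<^bsub>RS\<^esub> (y \<otimes>\<^bsub>RS\<^esub> z)"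
      using self.loc_smult_assoc[of x y z] x y z by (simp add: RS_sel)
  qed
  fix x y z assume "x \<in> carrier RS" "y \<in> carrier RS" "z \<in> carrier RS"
  then show "(x \<oplus>\<^bsub>RS\<^esub> y) \<otimes>\<^bsub>RS\<^esub> z = x \<otimes>\<^bsub>RS\<^esub> z \<oplus>\<^bsub>RS\<^esub> y \<otimes>\<^bsub>RS\<^esub> z"
    using self.loc_smult_l_distr[of x y z] by (simp add: RS_sel)
qed

theorem loc_module_module: "module RS L"
  by (rule moduleI)
     (simp_all add: loc_ring_cring loc_abelian loc_smult_closed loc_smult_l_distr
       loc_smult_r_distr loc_smult_assoc loc_smult_one)

lemma loc_map_add:
  "m \<in> carrier M \<Longrightarrow> n \<in> carrier M \<Longrightarrow> loc_map R S M (m \<oplus>\<^bsub>M\<^esub> n) = loc_map R S M m \<oplus>\<^bsub>L\<^esub> loc_map R S M n"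
  by (simp add: loc_map_def loc_add)

lemma loc_map_smult:
  "a \<in> carrier R \<Longrightarrow> m \<in> carrier M \<Longrightarrow> loc_map R S M (a \<odot>\<^bsub>M\<^esub> m) = frR a \<one> \<odot>\<^bsub>L\<^esub> loc_map R S M m"
  by (simp add: loc_map_def loc_smult)

lemma Sat_submodule:
  assumes "N \<subseteq> carrier M"
  shows "submodule (Sat R S M N) R M"
proof -
  interpret LM: module RS L by (rule loc_module_module)
  have zero: "loc_map R S M \<zero>\<^bsub>M\<^esub> \<in> H" if "submodule H RS L" for H
    using subgroup.one_closed[OF submodule.axioms(1)[OF that]] by (simp add: loc_map_def loc_zero)
  have smult: "a \<odot>\<^bsub>M\<^esub> m \<in> Sat R S M N" if "a \<in> carrier R" "m \<in> Sat R S M N" for a m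
    using that LM.submoduleE(4)
    by (auto simp: Sat_def generated_submodule_def loc_map_smult RS_sel)
  show ?thesis
  proof (rule submoduleI)
    fix m assume m: "m \<in> Sat R S M N"
    then have "(\<ominus> \<one>) \<odot>\<^bsub>M\<^esub> m \<in> Sat R S M N" by (intro smult) auto
    then show "\<ominus>\<^bsub>M\<^esub> m \<in> Sat R S M N" using m by (simp add: Sat_def smult_l_minus)
  next
    fix m n assume "m \<in> Sat R S M N" "n \<in> Sat R S M N"
    then show "m \<oplus>\<^bsub>M\<^esub> n \<in> Sat R S M N"
      using LM.submoduleE(5) by (auto simp: Sat_def generated_submodule_def loc_map_add)
  qed (use zero smult in \<open>auto simp: Sat_def generated_submodule_def\<close>)
qed

end

end

theory Submission
  imports Defs
begin

text \<open>
  An element of \<open>M\<close> lies in the saturation of \<open>N\<close> iff some element of \<open>S\<close> multiplies it into \<open>N\<close>.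
  A finite set of such elements therefore has a common multiplier \<open>u\<close>. If \<open>s\<close> multiplies the
  saturation into the span of this finite set, then \<open>u s\<close> multiplies the saturation into \<open>N\<close>, which
  makes it a colon submodule, and multiplies \<open>N\<close> into the span of the \<open>u\<close>-multiples of the finite
  set. Conversely, compose the multiplier from the saturation into \<open>N\<close> with the one from \<open>N\<close> into a
  finitely generated submodule.
\<close>

section \<open>Submodules, spans and \<open>S\<close>-finiteness within an ambient module\<close>

context module
begin

text \<open>Negatives come from scaling by -1. The closure conditions are spelled out so that
  submodules taken in different records can be compared by unfolding.\<close>

lemma submodule_iff:
  "submodule H R M \<longleftrightarrow> H \<subseteq> carrier M \<and> \<zero>\<^bsub>M\<^esub> \<in> H \<and>
     (\<forall>a\<in>carrier R. \<forall>x\<in>H. a \<odot>\<^bsub>M\<^esub> x \<in> H) \<and> (\<forall>x\<in>H. \<forall>y\<in>H. x \<oplus>\<^bsub>M\<^esub> y \<in> H)"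
proof
  assume H: "submodule H R M"
  have "\<zero>\<^bsub>M\<^esub> \<in> H"
    using subgroup.one_closed[OF submodule.axioms(1)[OF H]] by simp
  then show "H \<subseteq> carrier M \<and> \<zero>\<^bsub>M\<^esub> \<in> H \<and>
     (\<forall>a\<in>carrier R. \<forall>x\<in>H. a \<odot>\<^bsub>M\<^esub> x \<in> H) \<and> (\<forall>x\<in>H. \<forall>y\<in>H. x \<oplus>\<^bsub>M\<^esub> y \<in> H)"
    using submoduleE(1,4,5)[OF H] by auto
next
  assume H: "H \<subseteq> carrier M \<and> \<zero>\<^bsub>M\<^esub> \<in> H \<and>
     (\<forall>a\<in>carrier R. \<forall>x\<in>H. a \<odot>\<^bsub>M\<^esub> x \<in> H) \<and> (\<forall>x\<in>H. \<forall>y\<in>H. x \<oplus>\<^bsub>M\<^esub> y \<in> H)"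
  show "submodule H R M"
  proof (rule submoduleI)
    fix x assume x: "x \<in> H"
    then have "(\<ominus> \<one>) \<odot>\<^bsub>M\<^esub> x \<in> H"
      using H by auto
    moreover have "x \<in> carrier M"
      using x H by auto
    ultimately show "\<ominus>\<^bsub>M\<^esub> x \<in> H"
      by (simp add: smult_l_minus)
  qed (use H in auto)
qed

text \<open>Since \<open>K\<close> is a module in its own right, \<open>submodule_iff\<close>
  applies on both sides, and the record update keeps all operations.\<close>

lemma submodule_carrier_update_iff:
  assumes "submodule K R M"
  shows "submodule H R (M\<lparr>carrier := K\<rparr>) \<longleftrightarrow> submodule H R M \<and> H \<subseteq> K"
proof -
  interpret K: module R "M\<lparr>carrier := K\<rparr>"
    using assms module_axioms by (rule submodule.submodule_is_module)
  have "K \<subseteq> carrier M"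
    using assms by (simp add: submodule_iff)
  then show ?thesis
    unfolding K.submodule_iff submodule_iff by auto
qed

text \<open>Preimage of \<open>H\<close> under multiplication by \<open>s\<close>, which is linear
  because \<open>R\<close> is commutative. It allows a span to be placed inside a colon by checking
  generators only.\<close>

lemma submodule_colon:
  assumes "submodule H R M" "s \<in> carrier R"
  shows "submodule (colon M H s) R M"
proof -
  have "s \<odot>\<^bsub>M\<^esub> (a \<odot>\<^bsub>M\<^esub> x) = a \<odot>\<^bsub>M\<^esub> (s \<odot>\<^bsub>M\<^esub> x)" if "a \<in> carrier R" "x \<in> carrier M" for a x
    using that assms(2) by (metis R.m_comm smult_assoc1)
  then show ?thesis
    using assms unfolding submodule_iff colon_def by (auto simp: smult_r_distr)
qed

lemma submodule_generated:
  assumes "A \<subseteq> carrier M"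
  shows "submodule (generated_submodule R M A) R M"
proof -
  \<comment> \<open>The intersected family has a member, so the intersection stays inside the
    carrier.\<close>
  have "submodule (carrier M) R M"
    by (simp add: submodule_iff)
  then have "generated_submodule R M A \<subseteq> carrier M"
    using assms by (auto simp: generated_submodule_def)
  then show ?thesis
    unfolding submodule_iff[of "generated_submodule R M A"]
    by (auto simp: generated_submodule_def submodule_iff)
qed

lemma generated_submodule_incl: "A \<subseteq> generated_submodule R M A"
  by (auto simp: generated_submodule_def)

lemma generated_submodule_minimal:
  "submodule H R M \<Longrightarrow> A \<subseteq> H \<Longrightarrow> generated_submodule R M A \<subseteq> H"
  by (auto simp: generated_submodule_def)

text \<open>The span taken in \<open>M\<close> already lies in \<open>K\<close> by minimality, so it
  is itself one of the submodules intersected when the span is taken in \<open>K\<close>.\<close>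

lemma generated_submodule_carrier_update:
  assumes K: "submodule K R M" and A: "A \<subseteq> K"
  shows "generated_submodule R (M\<lparr>carrier := K\<rparr>) A = generated_submodule R M A"
proof -
  have "A \<subseteq> carrier M"
    using K A by (auto simp: submodule_iff)
  then have "submodule (generated_submodule R M A) R M"
    by (rule submodule_generated)
  moreover have "generated_submodule R M A \<subseteq> K"
    using K A by (rule generated_submodule_minimal)
  ultimately have "generated_submodule R (M\<lparr>carrier := K\<rparr>) A \<subseteq> generated_submodule R M A"
    using generated_submodule_incl[of A] submodule_carrier_update_iff[OF K]
    by (auto simp: generated_submodule_def[of R "M\<lparr>carrier := K\<rparr>"])
  moreover have "generated_submodule R M A \<subseteq> generated_submodule R (M\<lparr>carrier := K\<rparr>) A"
    by (auto simp: generated_submodule_def submodule_carrier_update_iff[OF K])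
  ultimately show ?thesis
    by (rule antisym)
qed

text \<open>Replaces the finitely generated submodule by a finite generating set, so that all spans
  and colons live in \<open>M\<close> and nested carrier updates disappear.\<close>

lemma S_finite_submodule_iff:
  assumes K: "submodule K R M"
  shows "S_finite R S (M\<lparr>carrier := K\<rparr>) \<longleftrightarrow>
    (\<exists>A s. finite A \<and> A \<subseteq> K \<and> s \<in> S \<and> K \<subseteq> colon M (generated_submodule R M A) s)"
proof -
  have KM: "K \<subseteq> carrier M"
    using K by (simp add: submodule_iff)
  have fg: "finitely_generated_module R (M\<lparr>carrier := F\<rparr>) \<longleftrightarrow>
      (\<exists>A. finite A \<and> A \<subseteq> F \<and> generated_submodule R M A = F)" if "submodule F R M" for F
    using generated_submodule_carrier_update[OF that]
    by (auto simp: finitely_generated_module_def)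
  show ?thesis
  proof
    assume "S_finite R S (M\<lparr>carrier := K\<rparr>)"
    then obtain F s where "submodule F R M" "F \<subseteq> K" "s \<in> S" "\<forall>m\<in>K. s \<odot>\<^bsub>M\<^esub> m \<in> F"
      and "finitely_generated_module R (M\<lparr>carrier := F\<rparr>)"
      unfolding S_finite_def submodule_carrier_update_iff[OF K] by (auto simp: image_subset_iff)
    then show "\<exists>A s. finite A \<and> A \<subseteq> K \<and> s \<in> S \<and> K \<subseteq> colon M (generated_submodule R M A) s"
      using KM unfolding fg[OF \<open>submodule F R M\<close>] colon_def by blast
  next
    assume "\<exists>A s. finite A \<and> A \<subseteq> K \<and> s \<in> S \<and> K \<subseteq> colon M (generated_submodule R M A) s"
    then obtain A s where A: "finite A" "A \<subseteq> K" "s \<in> S" "K \<subseteq> colon M (generated_submodule R M A) s"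
      by blast
    let ?F = "generated_submodule R M A"
    have F: "submodule ?F R M" "?F \<subseteq> K"
      using A KM K by (auto intro!: submodule_generated dest: generated_submodule_minimal)
    then have "finitely_generated_module R (M\<lparr>carrier := ?F\<rparr>)"
      using A(1) generated_submodule_incl by (auto simp: fg)
    then show "S_finite R S (M\<lparr>carrier := K\<rparr>)"
      using A F unfolding S_finite_def submodule_carrier_update_iff[OF K]
      by (intro exI[of _ ?F] exI[of _ s]) (auto simp: colon_def)
  qed
qed

end

section \<open>Saturation as a union of colons, and the equivalence\<close>

context mult_loc
begin

interpretation self: mult_loc R "self_module R" S
  by (rule self_loc)

text \<open>An upper bound for the \<open>RS\<close>-span of the image of \<open>N\<close>: scalars
  contribute their denominators to \<open>S\<close>, and sums are put over a common
  denominator.\<close>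

lemma submodule_fractions:
  assumes N: "submodule N R M"
  shows "submodule {fr n t | n t. n \<in> N \<and> t \<in> S} RS L"
proof -
  interpret LM: module RS L by (rule loc_module_module)
  let ?K = "{fr n t | n t. n \<in> N \<and> t \<in> S}"
  have N': "N \<subseteq> carrier M" "\<zero>\<^bsub>M\<^esub> \<in> N"
    "\<And>a x. a \<in> carrier R \<Longrightarrow> x \<in> N \<Longrightarrow> a \<odot>\<^bsub>M\<^esub> x \<in> N" "\<And>x y. x \<in> N \<Longrightarrow> y \<in> N \<Longrightarrow> x \<oplus>\<^bsub>M\<^esub> y \<in> N"
    using N by (auto simp: submodule_iff)
  have "?K \<subseteq> carrier L"
    using N'(1) by auto
  moreover have "\<zero>\<^bsub>L\<^esub> \<in> ?K"
    using N'(2) S.one_closed unfolding loc_zero by blast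
  moreover have "x \<odot>\<^bsub>L\<^esub> y \<in> ?K" if xy: "x \<in> carrier RS" "y \<in> ?K" for x y
  proof -
    obtain a s n t where c: "a \<in> carrier R" "s \<in> S" "n \<in> N" "t \<in> S" and e: "x = frR a s" "y = fr n t"
      using xy by (auto simp: RS_sel self.loc_carrier)
    have "x \<odot>\<^bsub>L\<^esub> y = fr (a \<odot>\<^bsub>M\<^esub> n) (s \<otimes> t)"
      unfolding e using c N'(1) by (intro loc_smult) auto
    moreover have "a \<odot>\<^bsub>M\<^esub> n \<in> N" "s \<otimes> t \<in> S"
      using c N'(3) by auto
    ultimately show ?thesis
      by blast
  qed
  moreover have "x \<oplus>\<^bsub>L\<^esub> y \<in> ?K" if xy: "x \<in> ?K" "y \<in> ?K" for x y
  proof -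
    obtain m s n t where c: "m \<in> N" "s \<in> S" "n \<in> N" "t \<in> S" and e: "x = fr m s" "y = fr n t"
      using xy by auto
    have "x \<oplus>\<^bsub>L\<^esub> y = fr (t \<odot>\<^bsub>M\<^esub> m \<oplus>\<^bsub>M\<^esub> s \<odot>\<^bsub>M\<^esub> n) (s \<otimes> t)"
      unfolding e using c N'(1) by (intro loc_add) auto
    moreover have "t \<odot>\<^bsub>M\<^esub> m \<oplus>\<^bsub>M\<^esub> s \<odot>\<^bsub>M\<^esub> n \<in> N" "s \<otimes> t \<in> S"
      using c N'(3,4) by auto
    ultimately show ?thesis
      by blast
  qed
  ultimately show ?thesis
    unfolding LM.submodule_iff by (intro conjI ballI)
qed

text \<open>If m/1 = n/t with n in \<open>N\<close>, then u t m = u n for some u in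
  \<open>S\<close>, so u t multiplies m into \<open>N\<close>. Conversely, if u m is in
  \<open>N\<close>, then m/1 = (1/u)(u m/1) is a multiple of a generator.\<close>

lemma Sat_eq_Union_colon:
  assumes N: "submodule N R M"
  shows "Sat R S M N = (\<Union>u\<in>S. colon M N u)"
proof (intro equalityI subsetI)
  interpret LM: module RS L by (rule loc_module_module)
  have NM: "N \<subseteq> carrier M" and sm: "\<And>a x. a \<in> carrier R \<Longrightarrow> x \<in> N \<Longrightarrow> a \<odot>\<^bsub>M\<^esub> x \<in> N"
    using N by (auto simp: submodule_iff)
  fix m
  {
    assume "m \<in> Sat R S M N"
    moreover have "loc_map R S M ` N \<subseteq> {fr n t | n t. n \<in> N \<and> t \<in> S}"
      using S.one_closed unfolding loc_map_def by blast
    then have "generated_submodule RS L (loc_map R S M ` N) \<subseteq> {fr n t | n t. n \<in> N \<and> t \<in> S}"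
      by (rule LM.generated_submodule_minimal[OF submodule_fractions[OF N]])
    ultimately have m: "m \<in> carrier M" and "loc_map R S M m \<in> {fr n t | n t. n \<in> N \<and> t \<in> S}"
      unfolding Sat_def by blast+
    then obtain n t where n: "n \<in> N" "t \<in> S" "fr m \<one> = fr n t"
      by (auto simp: loc_map_def)
    have "n \<in> carrier M"
      using n NM by blast
    then obtain u where "u \<in> S" "u \<odot>\<^bsub>M\<^esub> (t \<odot>\<^bsub>M\<^esub> m) = u \<odot>\<^bsub>M\<^esub> n"
      using n m fr_eq_iff[of m n \<one> t] by auto
    then have "(u \<otimes> t) \<odot>\<^bsub>M\<^esub> m \<in> N"
      using m n sm[of u n] by (simp add: smult_assoc1)
    then show "m \<in> (\<Union>u\<in>S. colon M N u)"
      using m n \<open>u \<in> S\<close> by (auto simp: colon_def intro!: bexI[of _ "u \<otimes> t"])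
  next
    assume "m \<in> (\<Union>u\<in>S. colon M N u)"
    then obtain u where u: "u \<in> S" "m \<in> carrier M" "u \<odot>\<^bsub>M\<^esub> m \<in> N"
      by (auto simp: colon_def)
    have "fr m \<one> = fr (u \<odot>\<^bsub>M\<^esub> m) u"
      using u by (intro fr_eqI) auto
    then have eq: "loc_map R S M m = frR \<one> u \<odot>\<^bsub>L\<^esub> loc_map R S M (u \<odot>\<^bsub>M\<^esub> m)"
      using u by (simp add: loc_map_def loc_smult)
    have "loc_map R S M ` N \<subseteq> carrier L"
      using NM by (auto simp: loc_map_def)
    then have "submodule (generated_submodule RS L (loc_map R S M ` N)) RS L"
      by (rule LM.submodule_generated)
    moreover have "frR \<one> u \<in> carrier RS"
      using u by (simp add: RS_sel)
    moreover have "loc_map R S M (u \<odot>\<^bsub>M\<^esub> m) \<in> generated_submodule RS L (loc_map R S M ` N)"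
      using u by (intro subsetD[OF LM.generated_submodule_incl] imageI)
    ultimately have "loc_map R S M m \<in> generated_submodule RS L (loc_map R S M ` N)"
      unfolding eq by (rule LM.submoduleE(4))
    then show "m \<in> Sat R S M N"
      using u by (simp add: Sat_def)
  }
qed

lemma colon_mult:
  assumes "submodule N R M" "s \<in> carrier R" "t \<in> carrier R"
  shows "colon M N s \<subseteq> colon M N (t \<otimes> s)"
  using assms by (auto simp: colon_def submodule_iff smult_assoc1)

text \<open>Multiply the multipliers of the single elements: the colon by a product contains the
  colon by each factor.\<close>

lemma finite_subset_Sat:
  assumes N: "submodule N R M" and "finite A" "A \<subseteq> Sat R S M N"
  shows "\<exists>u\<in>S. A \<subseteq> colon M N u"
  using assms(2,3)
proof (induction A rule: finite_induct)
  case empty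
  then show ?case using S.one_closed by blast
next
  case (insert x A)
  then obtain u v where "u \<in> S" "A \<subseteq> colon M N u" "v \<in> S" "x \<in> colon M N v"
    by (auto simp: Sat_eq_Union_colon[OF N])
  then have "u \<otimes> v \<in> S" "insert x A \<subseteq> colon M N (u \<otimes> v)"
    using colon_mult[OF N, of u v] colon_mult[OF N, of v u] by (auto simp: R.m_comm)
  then show ?case by blast
qed

lemma S_finite_Sat_iff:
  assumes N: "submodule N R M"
  shows "S_finite R S (M\<lparr>carrier := Sat R S M N\<rparr>) \<longleftrightarrow>
    S_finite R S (M\<lparr>carrier := N\<rparr>) \<and> (\<exists>s\<in>S. Sat R S M N = colon M N s)"
proof -
  let ?Sat = "Sat R S M N" and ?gen = "generated_submodule R M"
  have NM: "N \<subseteq> carrier M"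
    using N by (simp add: submodule_iff)
  have Sat: "submodule ?Sat R M"
    by (rule Sat_submodule[OF NM])
  have N_Sat: "N \<subseteq> ?Sat"
    using NM by (auto simp: Sat_eq_Union_colon[OF N] colon_def subset_eq intro!: bexI[of _ \<one>])
  have Sat_M: "?Sat \<subseteq> carrier M"
    by (auto simp: Sat_def)
  show ?thesis
    unfolding S_finite_submodule_iff[OF N] S_finite_submodule_iff[OF Sat]
  proof (intro iffI conjI; (elim conjE exE bexE)?)
    fix A s assume A: "finite A" "A \<subseteq> ?Sat" "s \<in> S" "?Sat \<subseteq> colon M (?gen A) s"
    obtain u where u: "u \<in> S" "A \<subseteq> colon M N u"
      using finite_subset_Sat[OF N A(1,2)] by blast
    let ?B = "(\<lambda>x. u \<odot>\<^bsub>M\<^esub> x) ` A"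
    have B: "?B \<subseteq> N" "?B \<subseteq> carrier M"
      using u NM by (auto simp: colon_def)
    \<comment> \<open>\<open>s\<close> moves the saturation into the span of \<open>A\<close>, and
      \<open>u\<close> moves that span into \<open>H\<close>. This is used for \<open>N\<close> and
      for the span of \<open>?B\<close>.\<close>
    have colon_trans: "?Sat \<subseteq> colon M H (u \<otimes> s)" if "?gen A \<subseteq> colon M H u" for H
      using A(3,4) u(1) that by (auto simp: colon_def smult_assoc1 subset_eq)
    have "?Sat \<subseteq> colon M N (u \<otimes> s)"
      using N u by (intro colon_trans generated_submodule_minimal submodule_colon) auto
    then show "\<exists>s\<in>S. ?Sat = colon M N s"
      using Sat_eq_Union_colon[OF N] A(3) u(1) by (intro bexI[of _ "u \<otimes> s"]) auto
    \<comment> \<open>On generators this holds because \<open>u\<close> maps \<open>A\<close> onto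
      \<open>?B\<close>.\<close>
    have "?gen A \<subseteq> colon M (?gen ?B) u"
      using u B A(2) Sat_M generated_submodule_incl[of ?B]
      by (intro generated_submodule_minimal submodule_colon submodule_generated)
        (auto simp: colon_def)
    then have "N \<subseteq> colon M (?gen ?B) (u \<otimes> s)"
      using N_Sat colon_trans by blast
    then show "\<exists>A s. finite A \<and> A \<subseteq> N \<and> s \<in> S \<and> N \<subseteq> colon M (?gen A) s"
      using A u B by (intro exI[of _ ?B] exI[of _ "u \<otimes> s"]) auto
  next
    fix s A t assume s: "s \<in> S" "?Sat = colon M N s"
      and A: "finite A" "A \<subseteq> N" "t \<in> S" "N \<subseteq> colon M (?gen A) t"
    \<comment> \<open>\<open>s\<close> moves the saturation into \<open>N\<close>, then
      \<open>t\<close> moves \<open>N\<close> into the span of \<open>A\<close>.\<close>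
    have "?Sat \<subseteq> colon M (?gen A) (t \<otimes> s)"
      using A s by (auto simp: colon_def smult_assoc1)
    then show "\<exists>A s. finite A \<and> A \<subseteq> ?Sat \<and> s \<in> S \<and> ?Sat \<subseteq> colon M (?gen A) s"
      using A s(1) N_Sat by (intro exI[of _ A] exI[of _ "t \<otimes> s"]) auto
  qed
qed

end

theorem proposition4p8:
  fixes R :: "('a, 'x) ring_scheme" and M :: "('a, 'b, 'y) module_scheme"
    and S :: "'a set" and N :: "'b set"
  assumes "module R M" and "submonoid S R" and "submodule N R M"
  shows "S_finite R S (M\<lparr>carrier := Sat R S M N\<rparr>) \<longleftrightarrow>
    S_finite R S (M\<lparr>carrier := N\<rparr>) \<and> (\<exists>s\<in>S. Sat R S M N = colon M N s)"
  by (rule mult_loc.S_finite_Sat_iff) (simp_all add: assms mult_loc_def)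

end
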